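(* Let $A,B$ be the matrices defined in the context (uniform grid, linear boundary conditions), where the weights $w_{-1},w_0,w_1,w_2$ satisfy $\sum_{k=-1}^2 w_k=0$, $\sum_{k=-1}^2 k w_k=1$, $\sum_{k=-1}^2 k^2 w_k=0$, $w_2\le 0$. Let $V^{n+1}$ be given by the Crank--Nicolson scheme $$(I-\tfrac12\Delta t A)V^{n+1}=(I+\tfrac12\Delta t A)V^n+\tfrac12\Delta t\,(BV^n+BV^{n+1}),$$ let $Y_\ell$ ($\ell\ge 1$) be given by the fixed-point iteration (CNFI scheme) $$(I-\tfrac12\Delta t A)Y_\ell=(I+\tfrac12\Delta t A)V^n+\tfrac12\Delta t\,(BV^n+BY_{\ell-1}),$$ and set $\varepsilon_\ell=V^{n+1}-Y_\ell$. Let $$\kappa_x=(|w_2|+|w_1|+|w_{-1}|+w_0)\max_i|a_i|,\qquad \kappa_y=(|w_2|+|w_1|+|w_{-1}|+w_0)\max_j|b_j|.$$ If $\kappa_x\frac{\Delta t}{2\Delta x}+\kappa_y\frac{\Delta t}{2\Delta y}<1+\frac{\Delta t}{2}r$, then the CNFI iterates converge to the Crank--Nicolson solution in the $\ell_\infty$-norm (i.e. $\|\varepsilon_\ell\|_\infty\to0$ as $\ell\to\infty$) and, for all $\ell\ge1$, $$\|\varepsilon_\ell\|_\infty\le\Theta\,\|\varepsilon_{\ell-1}\|_\infty\quad\text{with}\quad \Theta=\frac{\frac{\Delta t}{2}\lambda}{1+\frac{\Delta t}{2}(r+\lambda)-\left(\kappa_x\frac{\Delta t}{2\Delta x}+\kappa_y\frac{\Delta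 t}{2\Delta y}\right)}<1.$$
   Context: Parameters: $\alpha,\beta,\sigma,\lambda,\Delta t>0$, $\mu,r\in\mathbb R$; $f$ is a bounded probability density on $\mathbb R$. Grid: $x_{\min}=x_0<\dots<x_{m_1}=x_{\max}$ and $y_{\min}=y_0<\dots<y_{m_2}=y_{\max}$ are uniform meshes with widths $\Delta x$, $\Delta y$. Vectors $V=(V_{i,j})_{0\le i\le m_1,0\le j\le m_2}\in\mathbb R^{(m_1+1)(m_2+1)}$, where $V_{i,j}$ is the entry with index $i(m_2+1)+j$; $I$ is the identity. Put $a_i=\alpha(\mu-x_i)$, $b_j=-\beta y_j$, $c^+=\max(c,0)$, $c^-=\min(c,0)$. Standing assumption: $a(x)=\alpha(\mu-x)$ and $b(y)=-\beta y$ change sign within the truncated domain, so that $a_0>0>a_{m_1}$ and $b_0>0>b_{m_2}$. The matrix $A$ is $A=A^D+A_x+A_y$ where: (i) $(A^DV)_{i,j}=\frac{\sigma^2}{2}\frac{V_{i-1,j}-2V_{i,j}+V_{i+1,j}}{\Delta x^2}-(r+\lambda)V_{i,j}$ for $1\le i\le m_1-1$, and $(A^DV)_{i,j}=-(r+\lambda)V_{i,j}$ for $i\in\{0,m_1\}$ (linear boundary condition: the second-derivative rows vanish at the boundary); (ii) $(A_xV)_{i,j}=a_i^+\frac{w_2V_{i+2,j}+w_1V_{i+1,j}+w_0V_{i,j}+w_{-1}V_{i-1,j}}{\Delta x}+a_i^-\frac{-w_{-1}V_{i+1,j}-w_0V_{i,j}-w_1V_{i-1,j}-w_2V_{i-2,j}}{\Delta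 x}$; (iii) $(A_yV)_{i,j}=b_j^+\frac{w_2V_{i,j+2}+w_1V_{i,j+1}+w_0V_{i,j}+w_{-1}V_{i,j-1}}{\Delta y}+b_j^-\frac{-w_{-1}V_{i,j+1}-w_0V_{i,j}-w_1V_{i,j-1}-w_2V_{i,j-2}}{\Delta y}$. Values at ghost points outside the grid are replaced by linear extrapolation: $V_{-1,j}=2V_{0,j}-V_{1,j}$, $V_{m_1+1,j}=2V_{m_1,j}-V_{m_1-1,j}$, and similarly in the $y$-direction. The matrix $B$ is $(BV)_{i,j}=\lambda\sum_{\ell=0}^{m_2}\tilde B_{j,\ell}V_{i,\ell}$, with $$\sum_{\ell=0}^{m_2}\tilde B_{j,\ell}U_\ell=\sum_{\ell=0}^{m_2-1}\int_{y_\ell}^{y_{\ell+1}}\Big(\frac{y_{\ell+1}-\xi}{\Delta y}U_\ell+\frac{\xi-y_\ell}{\Delta y}U_{\ell+1}\Big)f(\xi-y_j)\,d\xi\qquad (U\in\mathbb R^{m_2+1}),$$ i.e. $\tilde B_{j,\ell}$ is the integral of the piecewise linear hat function at $y_\ell$ (restricted to $[y_0,y_{m_2}]$) against $f(\cdot-y_j)$. $V^n$ (and $V^{n-1}$ if $n\ge1$) are the given approximations at earlier time levels; the starting vector is $Y_0=2V^n-V^{n-1}$ if $n\ge1$ and $Y_0=V^0$ if $n=0$. $\|\cdot\|_\infty$ is the maximum norm. *)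

theory Defs
  imports "HOL-Analysis.Analysis" "Jordan_Normal_Form.Matrix"
begin

(* Matrices and vectors below are those of Jordan_Normal_Form; the clashing syntax and names of
   the Cartesian products of HOL-Analysis are switched off. *)
no_notation vec_nth (infixl \<open>$\<close> 90)
hide_const (open) Finite_Cartesian_Product.vec Finite_Cartesian_Product.mat
  Finite_Cartesian_Product.row Finite_Cartesian_Product.column

definition bounded_prob_density :: "(real \<Rightarrow> real) \<Rightarrow> bool" where
  "bounded_prob_density f \<longleftrightarrow>
     f \<in> borel_measurable borel \<and> (\<forall>z. 0 \<le> f z) \<and> (\<exists>C. \<forall>z. f z \<le> C) \<and>
     integrable lborel f \<and> (LBINT z. f z) = 1"

definition max_norm :: "real vec \<Rightarrow> real" where
  "max_norm v = Max ((\<lambda>k. \<bar>v $ k\<bar>) ` {..<dim_vec v})"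

(* Grid functions are functions V i j of the two mesh indices, of which only the values with
   i <= m1, j <= m2 matter. The value V i j is the vector entry with index i * (m2 + 1) + j. *)

definition grid_dim :: "nat \<Rightarrow> nat \<Rightarrow> nat" where
  "grid_dim m1 m2 = (m1 + 1) * (m2 + 1)"

definition grid_fun :: "nat \<Rightarrow> real vec \<Rightarrow> nat \<Rightarrow> nat \<Rightarrow> real" where
  "grid_fun m2 v i j = v $ (i * (m2 + 1) + j)"

(* The matrix whose columns are the images of the unit grid functions; for a linear operator T
   this is its matrix, see mult_grid_mat. *)
definition grid_mat :: "nat \<Rightarrow> nat \<Rightarrow> ((nat \<Rightarrow> nat \<Rightarrow> real) \<Rightarrow> nat \<Rightarrow> nat \<Rightarrow> real) \<Rightarrow> real mat" where
  "grid_mat m1 m2 T = mat (grid_dim m1 m2) (grid_dim m1 m2)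
     (\<lambda>(p, q). T (\<lambda>k l. of_bool (k = q div (m2 + 1) \<and> l = q mod (m2 + 1)))
                 (p div (m2 + 1)) (p mod (m2 + 1)))"

(* Only the ghost indices -1 and m + 1 carry a nonzero coefficient when the velocity is
   positive at the left and negative at the right end of the mesh. *)
definition extrapolate :: "nat \<Rightarrow> (nat \<Rightarrow> real) \<Rightarrow> int \<Rightarrow> real" where
  "extrapolate m u k =
     (if k < 0 then u 0 + of_int k * (u 1 - u 0)
      else if k > int m then u m + of_int (k - int m) * (u m - u (m - 1))
      else u (nat k))"

(* One-dimensional upwind discretisation of c * du/dx at mesh point i, mesh width h. *)
definition upwind :: "nat \<Rightarrow> (int \<Rightarrow> real) \<Rightarrow> real \<Rightarrow> real \<Rightarrow> (nat \<Rightarrow> real) \<Rightarrow> nat \<Rightarrow> real" where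
  "upwind m w h c u i =
     (let U = extrapolate m u; k = int i in
        max c 0 * ((w 2 * U (k + 2) + w 1 * U (k + 1) + w 0 * U k + w (-1) * U (k - 1)) / h)
      + min c 0 * ((- w (-1) * U (k + 1) - w 0 * U k - w 1 * U (k - 1) - w 2 * U (k - 2)) / h))"

definition diffusion_op ::
  "nat \<Rightarrow> real \<Rightarrow> real \<Rightarrow> real \<Rightarrow> real \<Rightarrow> (nat \<Rightarrow> nat \<Rightarrow> real) \<Rightarrow> nat \<Rightarrow> nat \<Rightarrow> real" where
  "diffusion_op m1 \<sigma> r lam dx V i j =
     (if 1 \<le> i \<and> i < m1
      then \<sigma>\<^sup>2 / 2 * ((V (i - 1) j - 2 * V i j + V (i + 1) j) / dx\<^sup>2) - (r + lam) * V i j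
      else - (r + lam) * V i j)"

definition x_advection_op ::
  "nat \<Rightarrow> (int \<Rightarrow> real) \<Rightarrow> real \<Rightarrow> (nat \<Rightarrow> real) \<Rightarrow> (nat \<Rightarrow> nat \<Rightarrow> real) \<Rightarrow> nat \<Rightarrow> nat \<Rightarrow> real" where
  "x_advection_op m1 w dx a V i j = upwind m1 w dx (a i) (\<lambda>k. V k j) i"

definition y_advection_op ::
  "nat \<Rightarrow> (int \<Rightarrow> real) \<Rightarrow> real \<Rightarrow> (nat \<Rightarrow> real) \<Rightarrow> (nat \<Rightarrow> nat \<Rightarrow> real) \<Rightarrow> nat \<Rightarrow> nat \<Rightarrow> real" where
  "y_advection_op m2 w dy b V i j = upwind m2 w dy (b j) (\<lambda>l. V i l) j"

(* The integral of the piecewise linear interpolant of U against f(. - y_j) over [y_0, y_m2]. *)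
definition jump_integral ::
  "nat \<Rightarrow> real \<Rightarrow> (nat \<Rightarrow> real) \<Rightarrow> (real \<Rightarrow> real) \<Rightarrow> (nat \<Rightarrow> real) \<Rightarrow> nat \<Rightarrow> real" where
  "jump_integral m2 dy y f U j =
     (\<Sum>l<m2. LBINT z:{y l..y (l + 1)}.
        ((y (l + 1) - z) / dy * U l + (z - y l) / dy * U (l + 1)) * f (z - y j))"

(* The coefficient of U l in jump_integral, see jump_integral_eq_sum. *)
definition jump_weight ::
  "nat \<Rightarrow> real \<Rightarrow> (nat \<Rightarrow> real) \<Rightarrow> (real \<Rightarrow> real) \<Rightarrow> nat \<Rightarrow> nat \<Rightarrow> real" where
  "jump_weight m2 dy y f j l = jump_integral m2 dy y f (\<lambda>k. of_bool (k = l)) j"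

definition jump_op ::
  "nat \<Rightarrow> real \<Rightarrow> real \<Rightarrow> (nat \<Rightarrow> real) \<Rightarrow> (real \<Rightarrow> real) \<Rightarrow>
   (nat \<Rightarrow> nat \<Rightarrow> real) \<Rightarrow> nat \<Rightarrow> nat \<Rightarrow> real" where
  "jump_op m2 lam dy y f V i j = lam * (\<Sum>l\<le>m2. jump_weight m2 dy y f j l * V i l)"

definition A_mat ::
  "nat \<Rightarrow> nat \<Rightarrow> real \<Rightarrow> real \<Rightarrow> real \<Rightarrow> (int \<Rightarrow> real) \<Rightarrow> real \<Rightarrow> real \<Rightarrow>
   (nat \<Rightarrow> real) \<Rightarrow> (nat \<Rightarrow> real) \<Rightarrow> real mat" where
  "A_mat m1 m2 \<sigma> r lam w dx dy a b =
     grid_mat m1 m2 (diffusion_op m1 \<sigma> r lam dx)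
     + grid_mat m1 m2 (x_advection_op m1 w dx a)
     + grid_mat m1 m2 (y_advection_op m2 w dy b)"

definition B_mat ::
  "nat \<Rightarrow> nat \<Rightarrow> real \<Rightarrow> real \<Rightarrow> (nat \<Rightarrow> real) \<Rightarrow> (real \<Rightarrow> real) \<Rightarrow> real mat" where
  "B_mat m1 m2 lam dy y f = grid_mat m1 m2 (jump_op m2 lam dy y f)"


definition grid_linear :: "nat \<Rightarrow> nat \<Rightarrow> ((nat \<Rightarrow> nat \<Rightarrow> real) \<Rightarrow> nat \<Rightarrow> nat \<Rightarrow> real) \<Rightarrow> bool" where
  "grid_linear m1 m2 T \<longleftrightarrow>
     (\<forall>V W i j. T (\<lambda>k l. V k l + W k l) i j = T V i j + T W i j) \<and>
     (\<forall>c V i j. T (\<lambda>k l. c * V k l) i j = c * T V i j) \<and>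
     (\<forall>V W i j. (\<forall>k\<le>m1. \<forall>l\<le>m2. V k l = W k l) \<longrightarrow> i \<le> m1 \<longrightarrow> j \<le> m2 \<longrightarrow> T V i j = T W i j)"

lemma grid_index_less:
  assumes "i \<le> m1" "j \<le> m2"
  shows "i * (m2 + 1) + j < grid_dim m1 m2"
proof -
  have "i * (m2 + 1) + j < (i + 1) * (m2 + 1)" using assms by simp
  also have "\<dots> \<le> (m1 + 1) * (m2 + 1)" using assms by (intro mult_le_mono) auto
  finally show ?thesis by (simp add: grid_dim_def)
qed

lemma grid_index_iff:
  fixes k l q m2 :: nat
  assumes "l \<le> m2"
  shows "(k = q div (m2 + 1) \<and> l = q mod (m2 + 1)) \<longleftrightarrow> q = k * (m2 + 1) + l"
proof
  assume "k = q div (m2 + 1) \<and> l = q mod (m2 + 1)"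
  then show "q = k * (m2 + 1) + l" using div_mult_mod_eq[of q "m2 + 1"] by simp
next
  have "l < m2 + 1" using assms by simp
  moreover assume "q = k * (m2 + 1) + l"
  ultimately show "k = q div (m2 + 1) \<and> l = q mod (m2 + 1)"
    using div_mult_self3[of "m2 + 1" k l] mod_mult_self3[of k "m2 + 1" l]
      div_less[of l "m2 + 1"] mod_less[of l "m2 + 1"]
    by (simp del: add_Suc_right)
qed

lemma mult_grid_mat:
  assumes T: "grid_linear m1 m2 T" and v: "v \<in> carrier_vec (grid_dim m1 m2)"
    and i: "i \<le> m1" and j: "j \<le> m2"
  shows "grid_fun m2 (grid_mat m1 m2 T *\<^sub>v v) i j = T (grid_fun m2 v) i j"
proof -
  define N where "N = grid_dim m1 m2"
  define E :: "nat \<Rightarrow> nat \<Rightarrow> nat \<Rightarrow> real"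
    where "E = (\<lambda>q k l. of_bool (k = q div (m2 + 1) \<and> l = q mod (m2 + 1)))"
  have add: "T (\<lambda>k l. V k l + W k l) i j = T V i j + T W i j" for V W
    using T unfolding grid_linear_def by blast
  have scale: "T (\<lambda>k l. c * V k l) i j = c * T V i j" for c V
    using T unfolding grid_linear_def by blast
  have cong: "T V i j = T W i j" if "\<And>k l. k \<le> m1 \<Longrightarrow> l \<le> m2 \<Longrightarrow> V k l = W k l" for V W
    using T i j that unfolding grid_linear_def by blast
  have lin: "T (\<lambda>k l. \<Sum>q\<in>Q. v $ q * E q k l) i j = (\<Sum>q\<in>Q. v $ q * T (E q) i j)"
    if "finite Q" for Q
    using that
  proof (induction Q rule: finite_induct)
    case empty
    show ?case using scale[of 0 "\<lambda>k l. 0"] by simp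
  next
    case (insert q Q)
    show ?case
      using insert add[of "\<lambda>k l. v $ q * E q k l" "\<lambda>k l. \<Sum>q\<in>Q. v $ q * E q k l"]
        scale[of "v $ q" "E q"]
      by simp
  qed
  define p where "p = i * (m2 + 1) + j"
  have p: "p < N" unfolding p_def N_def by (rule grid_index_less[OF i j])
  have pdm: "p div (m2 + 1) = i" "p mod (m2 + 1) = j"
    using grid_index_iff[OF j, of i p] by (simp_all add: p_def)
  have "grid_fun m2 (grid_mat m1 m2 T *\<^sub>v v) i j = row (grid_mat m1 m2 T) p \<bullet> v"
    unfolding grid_fun_def p_def[symmetric]
    by (rule index_mult_mat_vec) (use p in \<open>simp add: grid_mat_def N_def\<close>)
  also have "\<dots> = (\<Sum>q\<in>{0..<N}. row (grid_mat m1 m2 T) p $ q * v $ q)"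
    using v by (simp add: scalar_prod_def N_def)
  also have "\<dots> = (\<Sum>q\<in>{0..<N}. v $ q * T (E q) i j)"
  proof (rule sum.cong[OF refl])
    fix q assume "q \<in> {0..<N}"
    then have "row (grid_mat m1 m2 T) p $ q = T (E q) (p div (m2 + 1)) (p mod (m2 + 1))"
      using p unfolding grid_mat_def E_def N_def[symmetric] by simp
    then show "row (grid_mat m1 m2 T) p $ q * v $ q = v $ q * T (E q) i j"
      unfolding pdm by (simp only: mult.commute)
  qed
  also have "\<dots> = T (\<lambda>k l. \<Sum>q\<in>{0..<N}. v $ q * E q k l) i j"
    by (rule lin[symmetric]) simp
  also have "\<dots> = T (grid_fun m2 v) i j"
  proof (rule cong)
    fix k l assume k: "k \<le> m1" and l: "l \<le> m2"
    have "(\<Sum>q\<in>{0..<N}. v $ q * E q k l)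
        = (\<Sum>q\<in>{0..<N}. if q = k * (m2 + 1) + l then v $ q else 0)"
      unfolding E_def grid_index_iff[OF l] by (rule sum.cong) simp_all
    also have "\<dots> = grid_fun m2 v k l"
      using grid_index_less[OF k l] by (subst sum.delta) (simp_all add: grid_fun_def N_def)
    finally show "(\<Sum>q\<in>{0..<N}. v $ q * E q k l) = grid_fun m2 v k l" .
  qed
  finally show ?thesis .
qed

lemma extrapolate_add: "extrapolate m (\<lambda>k. u k + v k) k = extrapolate m u k + extrapolate m v k"
  by (simp add: extrapolate_def algebra_simps)

lemma extrapolate_mult: "extrapolate m (\<lambda>k. c * u k) k = c * extrapolate m u k"
  by (simp add: extrapolate_def algebra_simps)

lemma extrapolate_cong:
  assumes "1 \<le> m" "\<And>k. k \<le> m \<Longrightarrow> u k = v k"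
  shows "extrapolate m u = extrapolate m v"
proof
  fix k
  show "extrapolate m u k = extrapolate m v k"
    using assms(1) assms(2)[of 0] assms(2)[of 1] assms(2)[of m] assms(2)[of "m - 1"]
      assms(2)[of "nat k"]
    by (auto simp: extrapolate_def)
qed

lemma upwind_add: "upwind m w h c (\<lambda>k. u k + v k) i = upwind m w h c u i + upwind m w h c v i"
proof -
  have "p * ((w3 * (A + A') + w2 * (B + B') + w1 * (C + C') + w0 * (D + D')) / h)
      + q * ((- w0 * (B + B') - w1 * (C + C') - w2 * (D + D') - w3 * (E + E')) / h)
    = (p * ((w3 * A + w2 * B + w1 * C + w0 * D) / h) + q * ((- w0 * B - w1 * C - w2 * D - w3 * E) / h))
    + (p * ((w3 * A' + w2 * B' + w1 * C' + w0 * D') / h)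
      + q * ((- w0 * B' - w1 * C' - w2 * D' - w3 * E') / h))"
    for p q w0 w1 w2 w3 A A' B B' C C' D D' E E' :: real
    unfolding times_divide_eq_right add_divide_distrib[symmetric]
    by (rule arg_cong[where f = "\<lambda>t. t / h"]) (simp only: algebra_simps)
  then show ?thesis
    unfolding upwind_def Let_def extrapolate_add .
qed

lemma upwind_mult: "upwind m w h c (\<lambda>k. d * u k) i = d * upwind m w h c u i"
proof -
  have "p * ((w3 * (d * A) + w2 * (d * B) + w1 * (d * C) + w0 * (d * D)) / h)
      + q * ((- w0 * (d * B) - w1 * (d * C) - w2 * (d * D) - w3 * (d * E)) / h)
    = d * (p * ((w3 * A + w2 * B + w1 * C + w0 * D) / h)
      + q * ((- w0 * B - w1 * C - w2 * D - w3 * E) / h))"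
    for p q w0 w1 w2 w3 A B C D E :: real
    unfolding times_divide_eq_right add_divide_distrib[symmetric]
    by (rule arg_cong[where f = "\<lambda>t. t / h"]) (simp only: algebra_simps)
  then show ?thesis
    unfolding upwind_def Let_def extrapolate_mult .
qed

lemma upwind_cong:
  assumes "1 \<le> m" "\<And>k. k \<le> m \<Longrightarrow> u k = v k"
  shows "upwind m w h c u i = upwind m w h c v i"
  using extrapolate_cong[OF assms] by (simp add: upwind_def)

lemma grid_linear_diffusion_op: "grid_linear m1 m2 (diffusion_op m1 \<sigma> r lam dx)"
  by (auto simp: grid_linear_def diffusion_op_def add_divide_distrib diff_divide_distrib
      algebra_simps)

lemma grid_linear_x_advection_op:
  "1 \<le> m1 \<Longrightarrow> grid_linear m1 m2 (x_advection_op m1 w dx a)"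
  by (auto simp: grid_linear_def x_advection_op_def upwind_add upwind_mult intro!: upwind_cong)

lemma grid_linear_y_advection_op:
  "1 \<le> m2 \<Longrightarrow> grid_linear m1 m2 (y_advection_op m2 w dy b)"
  by (auto simp: grid_linear_def y_advection_op_def upwind_add upwind_mult intro!: upwind_cong)

lemma grid_linear_jump_op: "grid_linear m1 m2 (jump_op m2 lam dy y f)"
  by (auto simp: grid_linear_def jump_op_def sum.distrib sum_distrib_left algebra_simps
      intro!: sum.cong)

lemma A_mat_mult:
  assumes "1 \<le> m1" "1 \<le> m2" "v \<in> carrier_vec (grid_dim m1 m2)" "i \<le> m1" "j \<le> m2"
  shows "grid_fun m2 (A_mat m1 m2 \<sigma> r lam w dx dy a b *\<^sub>v v) i j =
      diffusion_op m1 \<sigma> r lam dx (grid_fun m2 v) i j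
    + x_advection_op m1 w dx a (grid_fun m2 v) i j
    + y_advection_op m2 w dy b (grid_fun m2 v) i j"
proof -
  let ?N = "grid_dim m1 m2"
  have c: "grid_mat m1 m2 T \<in> carrier_mat ?N ?N" for T by (simp add: grid_mat_def)
  have idx: "i * (m2 + 1) + j < ?N" using grid_index_less assms by blast
  let ?D = "grid_mat m1 m2 (diffusion_op m1 \<sigma> r lam dx)"
  let ?X = "grid_mat m1 m2 (x_advection_op m1 w dx a)"
  let ?Y = "grid_mat m1 m2 (y_advection_op m2 w dy b)"
  have "A_mat m1 m2 \<sigma> r lam w dx dy a b *\<^sub>v v = ?D *\<^sub>v v + ?X *\<^sub>v v + ?Y *\<^sub>v v"
    unfolding A_mat_def using c assms(3)
    by (subst add_mult_distrib_mat_vec[of _ ?N ?N], simp_all add: add_mult_distrib_mat_vec[of _ ?N ?N])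
  moreover have "dim_vec (?D *\<^sub>v v) = ?N" "dim_vec (?X *\<^sub>v v) = ?N" "dim_vec (?Y *\<^sub>v v) = ?N"
    by (simp_all add: grid_mat_def)
  ultimately have "grid_fun m2 (A_mat m1 m2 \<sigma> r lam w dx dy a b *\<^sub>v v) i j =
      grid_fun m2 (?D *\<^sub>v v) i j + grid_fun m2 (?X *\<^sub>v v) i j + grid_fun m2 (?Y *\<^sub>v v) i j"
    using idx by (simp add: grid_fun_def del: index_mult_mat_vec)
  then show ?thesis
    using assms by (simp add: mult_grid_mat grid_linear_diffusion_op grid_linear_x_advection_op
        grid_linear_y_advection_op)
qed

lemma B_mat_mult:
  assumes "v \<in> carrier_vec (grid_dim m1 m2)" "i \<le> m1" "j \<le> m2"
  shows "grid_fun m2 (B_mat m1 m2 lam dy y f *\<^sub>v v) i j =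
    lam * (\<Sum>l\<le>m2. jump_weight m2 dy y f j l * grid_fun m2 v i l)"
  using mult_grid_mat[OF grid_linear_jump_op assms] by (simp add: B_mat_def jump_op_def)

lemma set_integrable_affine_times_density:
  assumes "bounded_prob_density f"
  shows "set_integrable lborel {s..t} (\<lambda>z. (p * z + q) * f (z - c))"
proof -
  obtain C where C: "\<And>z. f z \<le> C" using assms unfolding bounded_prob_density_def by blast
  have [measurable]: "f \<in> borel_measurable borel" and nn: "\<And>z. 0 \<le> f z"
    using assms unfolding bounded_prob_density_def by auto
  have "set_integrable lborel {s..t} (\<lambda>z. C * (\<bar>p * z\<bar> + \<bar>q\<bar>))"
    by (rule borel_integrable_atLeastAtMost') (intro continuous_intros)
  then show ?thesis
  proof (rule set_integrable_bound)
    show "set_borel_measurable lborel {s..t} (\<lambda>z. (p * z + q) * f (z - c))"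
      unfolding set_borel_measurable_def by measurable
    have "norm ((p * z + q) * f (z - c)) \<le> norm (C * (\<bar>p * z\<bar> + \<bar>q\<bar>))" for z
    proof -
      have "\<bar>p * z + q\<bar> * \<bar>f (z - c)\<bar> \<le> (\<bar>p * z\<bar> + \<bar>q\<bar>) * C"
        using nn[of "z - c"] C[of "z - c"] by (intro mult_mono) auto
      also have "\<dots> \<le> \<bar>C * (\<bar>p * z\<bar> + \<bar>q\<bar>)\<bar>" by (metis abs_ge_self mult.commute)
      finally show ?thesis by (simp add: abs_mult)
    qed
    then show "AE z in lborel. z \<in> {s..t} \<longrightarrow>
        norm ((p * z + q) * f (z - c)) \<le> norm (C * (\<bar>p * z\<bar> + \<bar>q\<bar>))"
      by simp
  qed
qed

lemma jump_integral_split: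
  assumes "bounded_prob_density f"
  shows "jump_integral m2 dy y f U j =
    (\<Sum>l<m2. U l * (LBINT z:{y l..y (l + 1)}. (y (l + 1) - z) / dy * f (z - y j))
          + U (l + 1) * (LBINT z:{y l..y (l + 1)}. (z - y l) / dy * f (z - y j)))"
  unfolding jump_integral_def
proof (rule sum.cong[OF refl])
  fix l
  have 1: "set_integrable lborel {y l..y (l + 1)} (\<lambda>z. (y (l + 1) - z) / dy * f (z - y j))"
    using set_integrable_affine_times_density[OF assms, of "y l" "y (l + 1)" "- 1 / dy" "y (l + 1) / dy" "y j"]
    by (simp add: diff_divide_distrib)
  have 2: "set_integrable lborel {y l..y (l + 1)} (\<lambda>z. (z - y l) / dy * f (z - y j))"
    using set_integrable_affine_times_density[OF assms, of "y l" "y (l + 1)" "1 / dy" "- y l / dy" "y j"]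
    by (simp add: diff_divide_distrib)
  have "(LBINT z:{y l..y (l + 1)}.
        ((y (l + 1) - z) / dy * U l + (z - y l) / dy * U (l + 1)) * f (z - y j))
      = (LBINT z:{y l..y (l + 1)}. U l * ((y (l + 1) - z) / dy * f (z - y j))
          + U (l + 1) * ((z - y l) / dy * f (z - y j)))"
    by (intro arg_cong[where f = "set_lebesgue_integral lborel _"] ext) (simp only: ring_distribs ac_simps)
  also have "\<dots> = U l * (LBINT z:{y l..y (l + 1)}. (y (l + 1) - z) / dy * f (z - y j))
      + U (l + 1) * (LBINT z:{y l..y (l + 1)}. (z - y l) / dy * f (z - y j))"
    using 1 2 by (subst set_integral_add) (simp_all only: set_integrable_mult_right set_integral_mult_right)
  finally show "(LBINT z:{y l..y (l + 1)}.
        ((y (l + 1) - z) / dy * U l + (z - y l) / dy * U (l + 1)) * f (z - y j)) = \<dots>" .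
qed

lemma jump_integral_eq_sum:
  assumes "bounded_prob_density f"
  shows "jump_integral m2 dy y f U j = (\<Sum>l\<le>m2. jump_weight m2 dy y f j l * U l)"
proof -
  let ?I = "\<lambda>l. LBINT z:{y l..y (l + 1)}. (y (l + 1) - z) / dy * f (z - y j)"
  let ?J = "\<lambda>l. LBINT z:{y l..y (l + 1)}. (z - y l) / dy * f (z - y j)"
  have "(\<Sum>k\<le>m2. jump_weight m2 dy y f j k * U k)
      = (\<Sum>k\<le>m2. \<Sum>l<m2. (of_bool (l = k) * ?I l + of_bool (l + 1 = k) * ?J l) * U k)"
    by (simp only: jump_weight_def jump_integral_split[OF assms] sum_distrib_right)
  also have "\<dots> = (\<Sum>l<m2. \<Sum>k\<le>m2. (of_bool (l = k) * ?I l + of_bool (l + 1 = k) * ?J l) * U k)"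
    by (rule sum.swap)
  also have "\<dots> = (\<Sum>l<m2. U l * ?I l + U (l + 1) * ?J l)"
  proof (rule sum.cong[OF refl])
    fix l assume l: "l \<in> {..<m2}"
    have "(of_bool (l = k) * ?I l + of_bool (l + 1 = k) * ?J l) * U k
        = (if k = l then U l * ?I l else 0) + (if k = l + 1 then U (l + 1) * ?J l else 0)" for k
      by auto
    then show "(\<Sum>k\<le>m2. (of_bool (l = k) * ?I l + of_bool (l + 1 = k) * ?J l) * U k)
        = U l * ?I l + U (l + 1) * ?J l"
      using l by (simp add: sum.distrib)
  qed
  finally show ?thesis by (simp only: jump_integral_split[OF assms])
qed

end

theory Submission
  imports Defs
begin

(* The iteration error satisfies (I - c A) e_l = c B e_(l-1) with c = dt / 2. Evaluate a row of
   I - c A at an entry where |v| attains its maximum: the diffusion stencil only helps there, and the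
   upwind stencil, with or without extrapolated ghost values, loses at most K |velocity| / h, where
   K = |w_2| + |w_1| + |w_(-1)| + w_0. Hence max_norm ((I - c A) v) is bounded below by the
   denominator of Theta times max_norm v. As B has nonnegative entries and row sums at most lambda,
   the map e_(l-1) -> e_l is a contraction. *)

section \<open>The maximum norm of vectors and grid functions\<close>

lemma abs_index_le_max_norm:
  assumes "k < dim_vec v"
  shows "\<bar>v $ k\<bar> \<le> max_norm v"
  unfolding max_norm_def using assms by (intro Max_ge) auto

text \<open>Positive dimension rules out the maximum of the empty set, whose value is
  unspecified.\<close>

lemma max_norm_attained:
  assumes "0 < dim_vec v"
  obtains k where "k < dim_vec v" "\<bar>v $ k\<bar> = max_norm v"
proof -
  have "max_norm v \<in> (\<lambda>k. \<bar>v $ k\<bar>) ` {..<dim_vec v}"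
    unfolding max_norm_def using assms by (intro Max_in) auto
  then show ?thesis using that by auto
qed

lemma abs_grid_fun_le_max_norm:
  assumes "v \<in> carrier_vec (grid_dim m1 m2)" "i \<le> m1" "j \<le> m2"
  shows "\<bar>grid_fun m2 v i j\<bar> \<le> max_norm v"
  unfolding grid_fun_def using assms grid_index_less[of i m1 j m2]
  by (intro abs_index_le_max_norm) simp

text \<open>Supplies the grid point at which a matrix row is evaluated: a maximising vector index is
  decoded into mesh indices by division with remainder by \<open>m2 + 1\<close>.\<close>

lemma max_norm_attained_on_grid:
  assumes v: "v \<in> carrier_vec (grid_dim m1 m2)"
  obtains i j where "i \<le> m1" "j \<le> m2" "\<bar>grid_fun m2 v i j\<bar> = max_norm v"
proof -
  have "0 < dim_vec v" using v by (simp add: grid_dim_def)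
  then obtain k where k: "k < dim_vec v" "\<bar>v $ k\<bar> = max_norm v"
    by (rule max_norm_attained)
  have "k < (m1 + 1) * (m2 + 1)" using k v by (simp add: grid_dim_def)
  then have "k div (m2 + 1) < m1 + 1" by (rule less_mult_imp_div_less)
  moreover have "k mod (m2 + 1) < m2 + 1" by (rule mod_less_divisor) simp
  moreover have "grid_fun m2 v (k div (m2 + 1)) (k mod (m2 + 1)) = v $ k"
    unfolding grid_fun_def div_mult_mod_eq ..
  ultimately show ?thesis using that k(2) by (metis less_Suc_eq_le Suc_eq_plus1)
qed

lemma max_norm_nonneg:
  assumes "0 < dim_vec v"
  shows "0 \<le> max_norm v"
  by (rule max_norm_attained[OF assms]) (metis abs_ge_zero)

lemma max_norm_smult:
  assumes "0 < dim_vec v"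
  shows "max_norm (c \<cdot>\<^sub>v v) = \<bar>c\<bar> * max_norm v"
proof (rule antisym)
  from assms have dim: "0 < dim_vec (c \<cdot>\<^sub>v v)" by simp
  then obtain k where "k < dim_vec v" "\<bar>(c \<cdot>\<^sub>v v) $ k\<bar> = max_norm (c \<cdot>\<^sub>v v)"
    using max_norm_attained[OF dim] by (metis index_smult_vec(2))
  then show "max_norm (c \<cdot>\<^sub>v v) \<le> \<bar>c\<bar> * max_norm v"
    using abs_index_le_max_norm[of k v] by (metis abs_ge_zero abs_mult index_smult_vec(1) mult_left_mono)
next
  obtain k where "k < dim_vec v" "\<bar>v $ k\<bar> = max_norm v"
    using max_norm_attained[OF assms] .
  then show "\<bar>c\<bar> * max_norm v \<le> max_norm (c \<cdot>\<^sub>v v)"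
    using abs_index_le_max_norm[of k "c \<cdot>\<^sub>v v"] by (metis abs_mult index_smult_vec)
qed

lemma smult_mat_mult_vec:
  fixes A :: "real mat"
  assumes "A \<in> carrier_mat nr nc" "v \<in> carrier_vec nc"
  shows "(c \<cdot>\<^sub>m A) *\<^sub>v v = c \<cdot>\<^sub>v (A *\<^sub>v v)"
  using assms by (intro eq_vecI) auto

section \<open>Upwind and diffusion stencils at a point of maximum\<close>

lemma sum_int_interval_minus1_2:
  fixes g :: "int \<Rightarrow> real"
  shows "(\<Sum>k\<in>{-1..2}. g k) = g (-1) + g 0 + g 1 + g 2"
proof -
  have "{-1..2::int} = {-1, 0, 1, 2}" by auto
  then show ?thesis by (simp only:) (simp add: add.assoc)
qed

text \<open>The three moment conditions form a linear system of rank 3 in four unknowns, so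
  \<open>w 2\<close> stays as the only free parameter. With \<open>w 2 \<le> 0\<close> this fixes
  the signs \<open>w 0 \<le> 0\<close> and \<open>w 1 > 0\<close>, while the sign of
  \<open>w (-1)\<close> stays open.\<close>

lemma upwind_weights_solve:
  fixes w :: "int \<Rightarrow> real"
  assumes "(\<Sum>k\<in>{-1..2}. w k) = 0" "(\<Sum>k\<in>{-1..2}. of_int k * w k) = 1"
    "(\<Sum>k\<in>{-1..2}. (of_int k)\<^sup>2 * w k) = 0"
  shows "w (-1) = - 1 / 2 - w 2" "w 0 = 3 * w 2" "w 1 = 1 / 2 - 3 * w 2"
  using assms unfolding sum_int_interval_minus1_2 by (simp_all add: power2_eq_square)

text \<open>Reflecting the mesh exchanges the two kinds of ghost points. This reduces negative
  velocities to positive ones.\<close>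

lemma extrapolate_reflect:
  assumes "1 \<le> m"
  shows "extrapolate m (\<lambda>k. u (m - k)) k = extrapolate m u (int m - k)"
proof -
  have "m - nat k = nat (int m - k)" if "0 \<le> k" "k \<le> int m" using that by linarith
  then show ?thesis using assms by (auto simp: extrapolate_def algebra_simps)
qed

text \<open>Since \<open>u i\<close> equals \<open>M\<close> exactly, the central term is
  \<open>w 0 * M\<close> with its sign kept, which is why \<open>K\<close> contains
  \<open>w 0\<close> and not its absolute value. The neighbours are only known to lie in
  \<open>[-M, M]\<close> and cost the absolute values of their coefficients. Near the ends, ghost
  values are first rewritten through grid values, and the regrouped coefficients must still be
  bounded by \<open>K\<close>.\<close>

lemma upwind_stencil_le:
  fixes w :: "int \<Rightarrow> real" and u :: "nat \<Rightarrow> real"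
  defines "K \<equiv> \<bar>w 2\<bar> + \<bar>w 1\<bar> + \<bar>w (-1)\<bar> + w 0"
  assumes w: "w (-1) = - 1 / 2 - w 2" "w 0 = 3 * w 2" "w 1 = 1 / 2 - 3 * w 2" "w 2 \<le> 0"
    and im: "i < m" and bound: "\<And>k. k \<le> m \<Longrightarrow> \<bar>u k\<bar> \<le> M" and max: "u i = M"
  shows "w 2 * extrapolate m u (int i + 2) + w 1 * extrapolate m u (int i + 1)
    + w 0 * extrapolate m u (int i) + w (-1) * extrapolate m u (int i - 1) \<le> K * M"
    (is "?S \<le> _")
proof -
  have M: "0 \<le> M" using bound[of 0] by simp
  have le: "p * u k \<le> \<bar>p\<bar> * M" if "k \<le> m" for p k
    by (metis abs_ge_self abs_ge_zero abs_mult bound mult_left_mono order_trans that)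
  have U: "extrapolate m u (int k) = u k" if "k \<le> m" for k
    using that by (simp add: extrapolate_def)
  have U0: "extrapolate m u (int i) = M" using U im max by simp
  have U1: "extrapolate m u (int i + 1) = u (i + 1)" using U[of "i + 1"] im by (simp add: add.commute)
  have scale: "p * M \<le> K * M" if "p \<le> K" for p using M that by (rule mult_right_mono[rotated])
  have U2: "extrapolate m u (int i + 2) = u (i + 2)" if "i + 2 \<le> m"
    using U[OF that] by (simp add: add.commute)
  have U2': "extrapolate m u (int i + 2) = 2 * u (i + 1) - M" if "m = i + 1"
    using that max by (simp add: extrapolate_def)
  have Um: "extrapolate m u (int i - 1) = u (i - 1)" if "0 < i"
    using U[of "i - 1"] that im by (simp add: of_nat_diff)
  have Um': "extrapolate m u (int i - 1) = 2 * M - u 1" if "i = 0"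
    using that max by (simp add: extrapolate_def)
  \<comment> \<open>As \<open>i < m\<close>, the stencil reaches at most the ghost points -1 and
    \<open>m + 1\<close>. The cases record which of them occur; both do only for
    \<open>m = 1\<close>.\<close>
  consider (inner) "0 < i" "i + 2 \<le> m" | (left) "i = 0" "2 \<le> m" | (right) "0 < i" "m = i + 1"
    | (single) "i = 0" "m = 1"
    using im by linarith
  then show ?thesis
  proof cases
    case inner
    then have "?S \<le> \<bar>w 2\<bar> * M + \<bar>w 1\<bar> * M + w 0 * M + \<bar>w (-1)\<bar> * M"
      unfolding U0 U1 U2[OF inner(2)] Um[OF inner(1)] by (intro add_mono le) auto
    then show ?thesis by (simp add: K_def algebra_simps)
  next
    case left
    then have i2: "i + 2 \<le> m" by simp
    have "?S = w 2 * u (i + 2) + (w 1 - w (-1)) * u 1 + (w 0 + 2 * w (-1)) * M"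
      unfolding U0 U1 U2[OF i2] Um'[OF left(1)] using left(1)
      by (simp add: algebra_simps)
    also have "\<dots> \<le> \<bar>w 2\<bar> * M + \<bar>w 1 - w (-1)\<bar> * M + (w 0 + 2 * w (-1)) * M"
      using left by (intro add_mono le) auto
    also have "\<dots> = (\<bar>w 2\<bar> + \<bar>w 1 - w (-1)\<bar> + w 0 + 2 * w (-1)) * M"
      by (simp add: algebra_simps)
    \<comment> \<open>Here \<open>w 1 - w (-1) = 1 - 2 * w 2\<close> is positive, so its absolute
      value plus \<open>2 * w (-1)\<close> is \<open>w 1 + w (-1)\<close>.\<close>
    also have "\<dots> \<le> K * M" using w by (intro scale) (simp add: K_def)
    finally show ?thesis .
  next
    case right
    have "?S = (w 1 + 2 * w 2) * u (i + 1) + w (-1) * u (i - 1) + (w 0 - w 2) * M"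
      unfolding U0 U1 U2'[OF right(2)] Um[OF right(1)] by (simp add: algebra_simps)
    also have "\<dots> \<le> \<bar>w 1 + 2 * w 2\<bar> * M + \<bar>w (-1)\<bar> * M + (w 0 - w 2) * M"
      using right by (intro add_mono le) auto
    also have "\<dots> = (\<bar>w 1 + 2 * w 2\<bar> + \<bar>w (-1)\<bar> + w 0 - w 2) * M" by (simp add: algebra_simps)
    \<comment> \<open>Here \<open>w 1 + 2 * w 2 = 1 / 2 - w 2\<close> is positive and at most
      \<open>w 1\<close>, and \<open>- w 2\<close> is the absolute value of
      \<open>w 2\<close>.\<close>
    also have "\<dots> \<le> K * M" using w by (intro scale) (simp add: K_def)
    finally show ?thesis .
  next
    case single
    then have m: "m = i + 1" by simp
    \<comment> \<open>All stencil values lie on the line through the two grid values, and the moment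
      conditions make the stencil exact on linear data, so it returns the slope.\<close>
    have "?S = u 1 - M"
      unfolding U0 U1 U2'[OF m] Um'[OF single(1)] w(1-3) using single(1)
      by (simp add: algebra_simps)
    also have "\<dots> \<le> 0 * M" using bound[of 1] single by simp
    also have "\<dots> \<le> K * M" using w by (intro scale) (simp add: K_def)
    finally show ?thesis .
  qed
qed

text \<open>The assumptions \<open>right\<close> and \<open>left\<close> say that the velocity
  points into the mesh at its ends, so the stencil bound applies directly for \<open>c > 0\<close>
  and to the reflected mesh for \<open>c < 0\<close>.\<close>

lemma upwind_le:
  fixes w :: "int \<Rightarrow> real" and u :: "nat \<Rightarrow> real"
  defines "K \<equiv> \<bar>w 2\<bar> + \<bar>w 1\<bar> + \<bar>w (-1)\<bar> + w 0"
  assumes w: "w (-1) = - 1 / 2 - w 2" "w 0 = 3 * w 2" "w 1 = 1 / 2 - 3 * w 2" "w 2 \<le> 0"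
    and im: "i \<le> m" and bound: "\<And>k. k \<le> m \<Longrightarrow> \<bar>u k\<bar> \<le> M" and max: "u i = M"
    and h: "0 < h" and right: "0 < c \<Longrightarrow> i < m" and left: "c < 0 \<Longrightarrow> 0 < i"
  shows "upwind m w h c u i \<le> \<bar>c\<bar> / h * (K * M)"
proof -
  consider "c = 0" | (pos) "0 < c" | (neg) "c < 0" by linarith
  then show ?thesis
  proof cases
    case pos
    have "upwind m w h c u i = c / h * (w 2 * extrapolate m u (int i + 2)
        + w 1 * extrapolate m u (int i + 1) + w 0 * extrapolate m u (int i)
        + w (-1) * extrapolate m u (int i - 1))"
      using pos by (simp add: upwind_def Let_def)
    also have "\<dots> \<le> c / h * (K * M)"
      unfolding K_def using pos h upwind_stencil_le[where u = u, OF w right bound max]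
      by (intro mult_left_mono) auto
    finally show ?thesis using pos by simp
  next
    case neg
    let ?v = "\<lambda>k. u (m - k)" and ?k = "m - i"
    have m: "1 \<le> m" and i: "int ?k = int m - int i" using left neg im by linarith+
    have "upwind m w h c u i = - c / h * (w 2 * extrapolate m u (int i - 2)
        + w 1 * extrapolate m u (int i - 1) + w 0 * extrapolate m u (int i)
        + w (-1) * extrapolate m u (int i + 1))"
      using neg by (simp add: upwind_def Let_def algebra_simps diff_divide_distrib add_divide_distrib)
    \<comment> \<open>In mirrored coordinates the downwind-facing stencil becomes the one for
      positive velocity, with the positive factor \<open>- c / h\<close>.\<close>
    also have "\<dots> = - c / h * (w 2 * extrapolate m ?v (int ?k + 2)
        + w 1 * extrapolate m ?v (int ?k + 1) + w 0 * extrapolate m ?v (int ?k)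
        + w (-1) * extrapolate m ?v (int ?k - 1))"
      unfolding extrapolate_reflect[OF m] i by (simp add: algebra_simps)
    also have "\<dots> \<le> - c / h * (K * M)"
      unfolding K_def using neg h left im max bound
      by (intro mult_left_mono upwind_stencil_le[where u = ?v, OF w]) (auto simp: divide_le_0_iff)
    finally show ?thesis using neg by simp
  qed (simp add: upwind_def)
qed

text \<open>At a maximum along the x-direction the second difference is nonpositive; in the boundary
  rows it is absent and equality holds.\<close>

lemma diffusion_op_le:
  assumes "i \<le> m1" "\<And>k. k \<le> m1 \<Longrightarrow> V k j \<le> V i j"
  shows "diffusion_op m1 \<sigma> r lam dx V i j \<le> - (r + lam) * V i j"
proof (cases "1 \<le> i \<and> i < m1")
  case True
  then have "V (i - 1) j - 2 * V i j + V (i + 1) j \<le> 0"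
    using assms(2)[of "i - 1"] assms(2)[of "i + 1"] by linarith
  then have "\<sigma>\<^sup>2 / 2 * ((V (i - 1) j - 2 * V i j + V (i + 1) j) / dx\<^sup>2) \<le> 0"
    by (intro mult_nonneg_nonpos divide_nonpos_nonneg) auto
  then show ?thesis unfolding diffusion_op_def if_P[OF True] by linarith
next
  case False
  then show ?thesis by (auto simp: diffusion_op_def)
qed

section \<open>Lower bound for the implicit operator\<close>

lemma A_mat_carrier [simp]:
  "A_mat m1 m2 \<sigma> r lam w dx dy a b \<in> carrier_mat (grid_dim m1 m2) (grid_dim m1 m2)"
  by (simp add: A_mat_def grid_mat_def)

lemma B_mat_carrier [simp]:
  "B_mat m1 m2 lam dy y f \<in> carrier_mat (grid_dim m1 m2) (grid_dim m1 m2)"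
  by (simp add: B_mat_def grid_mat_def)

text \<open>This takes the place of a norm bound for the inverse: a single row, chosen where the
  entry of \<open>v\<close> has maximal modulus, already gives the estimate.\<close>

lemma max_norm_implicit_step_ge:
  fixes w :: "int \<Rightarrow> real" and a b :: "nat \<Rightarrow> real" and m1 m2 :: nat
  defines "K \<equiv> \<bar>w 2\<bar> + \<bar>w 1\<bar> + \<bar>w (-1)\<bar> + w 0"
    and "a' \<equiv> Max ((\<lambda>i. \<bar>a i\<bar>) ` {0..m1})" and "b' \<equiv> Max ((\<lambda>j. \<bar>b j\<bar>) ` {0..m2})"
  assumes w: "w (-1) = - 1 / 2 - w 2" "w 0 = 3 * w 2" "w 1 = 1 / 2 - 3 * w 2" "w 2 \<le> 0"
    and m: "1 \<le> m1" "1 \<le> m2" and d: "0 < dx" "0 < dy" and c: "0 \<le> c"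
    and sign: "a 0 > 0" "0 > a m1" "b 0 > 0" "0 > b m2"
    and v: "v \<in> carrier_vec (grid_dim m1 m2)"
  shows "(1 + c * (r + lam) - c * (K * a' / dx + K * b' / dy)) * max_norm v
    \<le> max_norm ((1\<^sub>m (grid_dim m1 m2) - c \<cdot>\<^sub>m A_mat m1 m2 \<sigma> r lam w dx dy a b) *\<^sub>v v)"
proof -
  let ?N = "grid_dim m1 m2" and ?A = "A_mat m1 m2 \<sigma> r lam w dx dy a b" and ?M = "max_norm v"
  let ?g = "(1\<^sub>m ?N - c \<cdot>\<^sub>m ?A) *\<^sub>v v"
  obtain i j where i: "i \<le> m1" and j: "j \<le> m2" and ij: "\<bar>grid_fun m2 v i j\<bar> = ?M"
    using max_norm_attained_on_grid[OF v] .
  \<comment> \<open>The sign \<open>s\<close> turns the entry of maximal modulus into a genuine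
    maximum of \<open>u\<close>, as the one-sided stencil bounds require. Linearity moves
    \<open>s\<close> through the three operators.\<close>
  define s :: real where "s = (if grid_fun m2 v i j < 0 then -1 else 1)"
  have s: "\<bar>s\<bar> = 1" by (simp add: s_def)
  define u where "u = (\<lambda>k l. s * grid_fun m2 v k l)"
  have uij: "u i j = ?M" using ij by (auto simp: u_def s_def)
  have bound: "\<bar>u k l\<bar> \<le> ?M" if "k \<le> m1" "l \<le> m2" for k l
    using abs_grid_fun_le_max_norm[OF v that] s by (simp add: u_def abs_mult)
  have M: "0 \<le> ?M" using ij by (metis abs_ge_zero)
  \<comment> \<open>The negative \<open>w 0 = 3 * w 2\<close> is outweighed by
    \<open>w 1 = 1 / 2 - 3 * w 2\<close>.\<close>
  have K: "0 \<le> K" using w by (simp add: K_def)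

  have "s * diffusion_op m1 \<sigma> r lam dx (grid_fun m2 v) i j = diffusion_op m1 \<sigma> r lam dx u i j"
    using grid_linear_diffusion_op unfolding grid_linear_def u_def by metis
  also have "\<dots> \<le> - (r + lam) * u i j"
    by (rule diffusion_op_le[OF i]) (use bound j uij abs_le_D1 in metis)
  finally have D: "s * diffusion_op m1 \<sigma> r lam dx (grid_fun m2 v) i j \<le> - (r + lam) * ?M"
    by (simp only: uij)

  have "s * x_advection_op m1 w dx a (grid_fun m2 v) i j = upwind m1 w dx (a i) (\<lambda>k. u k j) i"
    by (simp add: x_advection_op_def u_def upwind_mult)
  \<comment> \<open>The signs of \<open>a 0\<close> and \<open>a m1\<close> exclude outward velocity
    at the ends: \<open>a i > 0\<close> forces \<open>i < m1\<close>, and \<open>a i < 0\<close>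
    forces \<open>0 < i\<close>.\<close>
  also have "\<dots> \<le> \<bar>a i\<bar> / dx * (K * ?M)"
    unfolding K_def using i bound[OF _ j] uij d(1) sign
    by (intro upwind_le[OF w]) (auto simp: le_less intro!: gr0I)
  also have "\<dots> \<le> a' / dx * (K * ?M)"
    unfolding a'_def using i d K M
    by (intro mult_right_mono divide_right_mono Max_ge) auto
  finally have X: "s * x_advection_op m1 w dx a (grid_fun m2 v) i j \<le> K * a' / dx * ?M"
    by (simp add: mult_ac)

  have "s * y_advection_op m2 w dy b (grid_fun m2 v) i j = upwind m2 w dy (b j) (\<lambda>l. u i l) j"
    by (simp add: y_advection_op_def u_def upwind_mult)
  also have "\<dots> \<le> \<bar>b j\<bar> / dy * (K * ?M)"
    unfolding K_def using j bound[OF i] uij d(2) sign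
    by (intro upwind_le[OF w]) (auto simp: le_less intro!: gr0I)
  also have "\<dots> \<le> b' / dy * (K * ?M)"
    unfolding b'_def using j d K M
    by (intro mult_right_mono divide_right_mono Max_ge) auto
  finally have Y: "s * y_advection_op m2 w dy b (grid_fun m2 v) i j \<le> K * b' / dy * ?M"
    by (simp add: mult_ac)

  have "s * grid_fun m2 (?A *\<^sub>v v) i j \<le> - (r + lam) * ?M + K * a' / dx * ?M + K * b' / dy * ?M"
    unfolding A_mat_mult[OF m v i j] using D X Y by (simp only: distrib_left)
  then have "c * (s * grid_fun m2 (?A *\<^sub>v v) i j)
      \<le> c * (- (r + lam) * ?M + K * a' / dx * ?M + K * b' / dy * ?M)"
    using c by (rule mult_left_mono)
  moreover have "?g = v - c \<cdot>\<^sub>v (?A *\<^sub>v v)"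
    using v smult_mat_mult_vec[OF A_mat_carrier v, of c]
    by (simp add: minus_mult_distrib_mat_vec[of _ ?N ?N])
  then have "grid_fun m2 ?g i j = grid_fun m2 v i j - c * grid_fun m2 (?A *\<^sub>v v) i j"
    using grid_index_less[OF i j] carrier_matD(1)[OF A_mat_carrier]
    by (simp add: grid_fun_def del: index_mult_mat_vec)
  then have "s * grid_fun m2 ?g i j = ?M - c * (s * grid_fun m2 (?A *\<^sub>v v) i j)"
    unfolding uij[symmetric] by (simp only: u_def right_diff_distrib mult_ac)
  ultimately have "(1 + c * (r + lam) - c * (K * a' / dx + K * b' / dy)) * ?M
      \<le> s * grid_fun m2 ?g i j"
    by (simp add: algebra_simps)
  also have "\<dots> \<le> \<bar>grid_fun m2 ?g i j\<bar>"
    using s by (metis abs_ge_self abs_mult mult_1)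
  also have "\<dots> \<le> max_norm ?g"
    using mult_mat_vec_carrier[OF minus_carrier_mat[OF smult_carrier_mat[OF A_mat_carrier]] v] i j
    by (rule abs_grid_fun_le_max_norm)
  finally show ?thesis .
qed

section \<open>Norm bound for the jump matrix\<close>

lemma set_integral_sum_consecutive:
  fixes g :: "real \<Rightarrow> real" and y :: "nat \<Rightarrow> real"
  assumes g: "integrable lborel g" and y: "\<And>l. y l \<le> y (Suc l)"
  shows "(\<Sum>l<m. LBINT z:{y l..y (Suc l)}. g z) = (LBINT z:{y 0..y m}. g z)"
proof (induction m)
  case 0
  have "AE z in lborel. indicator {y 0} z *\<^sub>R g z = 0"
    using AE_lborel_singleton[of "y 0"] by eventually_elim simp
  then show ?case by (simp add: set_lebesgue_integral_def integral_eq_zero_AE)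
next
  case (Suc m)
  have int: "set_integrable lborel S g" if "S \<in> sets lborel" for S
    unfolding set_integrable_def using g that by (rule integrable_mult_indicator[rotated])
  have "y 0 \<le> y m" using y by (simp add: lift_Suc_mono_le)
  then have "{y 0..y (Suc m)} = {y 0..y m} \<union> {y m..y (Suc m)}" using y[of m] by auto
  \<comment> \<open>The closed intervals share only the point \<open>y m\<close>, a null
    set.\<close>
  moreover have "AE z in lborel. \<not> (z \<in> {y 0..y m} \<and> z \<in> {y m..y (Suc m)})"
    using AE_lborel_singleton[of "y m"] by auto
  ultimately show ?case using Suc int by (simp add: set_integral_Un_AE)
qed

text \<open>On each mesh interval both affine pieces of a hat function are nonnegative, and so is
  the density.\<close>

lemma jump_weight_nonneg:
  assumes "bounded_prob_density f" "0 < dy"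
  shows "0 \<le> jump_weight m2 dy y f j l"
proof -
  have "0 \<le> f z" for z using assms by (simp add: bounded_prob_density_def)
  then show ?thesis
    unfolding jump_weight_def jump_integral_def set_lebesgue_integral_def using assms(2)
    by (intro sum_nonneg integral_nonneg_AE AE_I2) (auto simp: indicator_def)
qed

text \<open>The hat functions form a partition of unity on the truncated domain, so the row sum is
  the probability mass that the shifted density puts there; truncation can only lose mass.\<close>

lemma sum_jump_weight_le_1:
  assumes f: "bounded_prob_density f" and dy: "0 < dy" and y: "\<And>l. y (Suc l) = y l + dy"
  shows "(\<Sum>l\<le>m2. jump_weight m2 dy y f j l) \<le> 1"
proof -
  have nn: "0 \<le> f z" for z using f by (simp add: bounded_prob_density_def)
  have int: "integrable lborel (\<lambda>z. f (z - y j))"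
    and one: "(LBINT z. f (z - y j)) = 1"
    using f lborel_integrable_real_affine[of f 1 "- y j"]
      lborel_integral_real_affine[of 1 f "- y j"]
    by (simp_all add: bounded_prob_density_def algebra_simps)
  \<comment> \<open>Summing the weights amounts to interpolating the constant 1.\<close>
  have "(\<Sum>l\<le>m2. jump_weight m2 dy y f j l) = jump_integral m2 dy y f (\<lambda>_. 1) j"
    by (simp add: jump_integral_eq_sum[OF f])
  also have "\<dots> = (\<Sum>l<m2. LBINT z:{y l..y (Suc l)}. f (z - y j))"
    unfolding jump_integral_def using dy
    by (simp add: y diff_divide_distrib[symmetric] add_divide_distrib[symmetric])
  also have "\<dots> = (LBINT z:{y 0..y m2}. f (z - y j))"
    using int dy by (intro set_integral_sum_consecutive) (simp_all add: y)
  also have "\<dots> \<le> (LBINT z. f (z - y j))"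
    unfolding set_lebesgue_integral_def using nn
    by (intro integral_mono integrable_mult_indicator int) (auto simp: indicator_def)
  finally show ?thesis by (simp add: one)
qed

text \<open>Each entry of the image is \<open>lam\<close> times a combination of entries of
  \<open>v\<close> with nonnegative weights of total at most 1.\<close>

lemma max_norm_B_mat_le:
  assumes f: "bounded_prob_density f" and dy: "0 < dy" and y: "\<And>l. y (Suc l) = y l + dy"
    and lam: "0 \<le> lam" and v: "v \<in> carrier_vec (grid_dim m1 m2)"
  shows "max_norm (B_mat m1 m2 lam dy y f *\<^sub>v v) \<le> lam * max_norm v"
proof -
  let ?B = "B_mat m1 m2 lam dy y f" and ?p = "jump_weight m2 dy y f"
  have Bv: "?B *\<^sub>v v \<in> carrier_vec (grid_dim m1 m2)"
    using B_mat_carrier v by (rule mult_mat_vec_carrier)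
  obtain i j where i: "i \<le> m1" and j: "j \<le> m2"
    and ij: "\<bar>grid_fun m2 (?B *\<^sub>v v) i j\<bar> = max_norm (?B *\<^sub>v v)"
    using max_norm_attained_on_grid[OF Bv] .
  have p: "0 \<le> ?p j l" for l using f dy by (rule jump_weight_nonneg)
  have M: "0 \<le> max_norm v" using v by (intro max_norm_nonneg) (simp add: grid_dim_def)
  have "\<bar>\<Sum>l\<le>m2. ?p j l * grid_fun m2 v i l\<bar> \<le> (\<Sum>l\<le>m2. ?p j l * max_norm v)"
    using p abs_grid_fun_le_max_norm[OF v i]
    by (intro sum_abs[THEN order_trans] sum_mono) (auto simp: abs_mult intro: mult_left_mono)
  also have "\<dots> \<le> 1 * max_norm v"
    unfolding sum_distrib_right[symmetric] using sum_jump_weight_le_1[where y = y, OF f dy y] M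
    by (rule mult_right_mono)
  finally show ?thesis
    using lam unfolding ij[symmetric] B_mat_mult[OF v i j] by (simp add: abs_mult mult_left_mono)
qed

section \<open>Error recursion and contraction of the iteration\<close>

theorem theorem1:
  fixes \<alpha> \<beta> \<sigma> lam \<Delta>t \<mu> r xmin xmax ymin ymax \<Delta>x \<Delta>y \<kappa>x \<kappa>y \<Theta> :: real
    and m1 m2 n :: nat
    and f :: "real \<Rightarrow> real"
    and w :: "int \<Rightarrow> real"
    and x y a b :: "nat \<Rightarrow> real"
    and A B I :: "real mat"
    and V Y \<epsilon> :: "nat \<Rightarrow> real vec"
  assumes params: "\<alpha> > 0" "\<beta> > 0" "\<sigma> > 0" "lam > 0" "\<Delta>t > 0"
    and density: "bounded_prob_density f"
    and grid: "m1 \<ge> 1" "m2 \<ge> 1" "xmin < xmax" "ymin < ymax"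
    and widths: "\<Delta>x = (xmax - xmin) / real m1" "\<Delta>y = (ymax - ymin) / real m2"
    and mesh: "\<And>i. x i = xmin + real i * \<Delta>x" "\<And>j. y j = ymin + real j * \<Delta>y"
    and velocities: "\<And>i. a i = \<alpha> * (\<mu> - x i)" "\<And>j. b j = - \<beta> * y j"
    and sign_change: "a 0 > 0" "0 > a m1" "b 0 > 0" "0 > b m2"
    and weights: "(\<Sum>k\<in>{-1..2}. w k) = 0" "(\<Sum>k\<in>{-1..2}. of_int k * w k) = 1"
      "(\<Sum>k\<in>{-1..2}. (of_int k)\<^sup>2 * w k) = 0" "w 2 \<le> 0"
    and A: "A = A_mat m1 m2 \<sigma> r lam w \<Delta>x \<Delta>y a b"
    and B: "B = B_mat m1 m2 lam \<Delta>y y f"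
    and I: "I = 1\<^sub>m (grid_dim m1 m2)"
    and V_carrier: "V n \<in> carrier_vec (grid_dim m1 m2)" "V (n + 1) \<in> carrier_vec (grid_dim m1 m2)"
      "n \<ge> 1 \<Longrightarrow> V (n - 1) \<in> carrier_vec (grid_dim m1 m2)"
    and Y_carrier: "\<And>l. Y l \<in> carrier_vec (grid_dim m1 m2)"
    and crank_nicolson:
      "(I - (\<Delta>t / 2) \<cdot>\<^sub>m A) *\<^sub>v V (n + 1) =
       (I + (\<Delta>t / 2) \<cdot>\<^sub>m A) *\<^sub>v V n + (\<Delta>t / 2) \<cdot>\<^sub>v (B *\<^sub>v V n + B *\<^sub>v V (n + 1))"
    and start: "Y 0 = (if n \<ge> 1 then 2 \<cdot>\<^sub>v V n - V (n - 1) else V 0)"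
    and CNFI: "\<And>l. l \<ge> 1 \<Longrightarrow>
      (I - (\<Delta>t / 2) \<cdot>\<^sub>m A) *\<^sub>v Y l =
      (I + (\<Delta>t / 2) \<cdot>\<^sub>m A) *\<^sub>v V n + (\<Delta>t / 2) \<cdot>\<^sub>v (B *\<^sub>v V n + B *\<^sub>v Y (l - 1))"
    and error: "\<And>l. \<epsilon> l = V (n + 1) - Y l"
    and \<kappa>x: "\<kappa>x = (\<bar>w 2\<bar> + \<bar>w 1\<bar> + \<bar>w (-1)\<bar> + w 0) * Max ((\<lambda>i. \<bar>a i\<bar>) ` {0..m1})"
    and \<kappa>y: "\<kappa>y = (\<bar>w 2\<bar> + \<bar>w 1\<bar> + \<bar>w (-1)\<bar> + w 0) * Max ((\<lambda>j. \<bar>b j\<bar>) ` {0..m2})"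
    and \<Theta>: "\<Theta> = (\<Delta>t / 2 * lam) /
      (1 + \<Delta>t / 2 * (r + lam) - (\<kappa>x * (\<Delta>t / (2 * \<Delta>x)) + \<kappa>y * (\<Delta>t / (2 * \<Delta>y))))"
    and step_condition:
      "\<kappa>x * (\<Delta>t / (2 * \<Delta>x)) + \<kappa>y * (\<Delta>t / (2 * \<Delta>y)) < 1 + \<Delta>t / 2 * r"
  shows "(\<lambda>l. max_norm (\<epsilon> l)) \<longlonglongrightarrow> 0 \<and>
    (\<forall>l\<ge>1. max_norm (\<epsilon> l) \<le> \<Theta> * max_norm (\<epsilon> (l - 1))) \<and>
    \<Theta> < 1"
proof -
  let ?c = "\<Delta>t / 2" and ?N = "grid_dim m1 m2"
  let ?q = "\<kappa>x * (\<Delta>t / (2 * \<Delta>x)) + \<kappa>y * (\<Delta>t / (2 * \<Delta>y))"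
  let ?D = "1 + ?c * (r + lam) - ?q"
  have d: "0 < \<Delta>x" "0 < \<Delta>y" using grid widths by simp_all
  have c: "0 < ?c" using params by simp
  \<comment> \<open>The difference of the two sides is \<open>1 + \<Delta>t / 2 * r - ?q\<close>, so
    this is the step condition itself; it yields both \<open>?D > 0\<close> and
    \<open>\<Theta> < 1\<close>.\<close>
  have D: "?c * lam < ?D" using step_condition unfolding distrib_left by linarith
  have cl: "0 < ?c * lam" using c params by (intro mult_pos_pos)
  have \<Theta>_range: "0 < \<Theta>" "\<Theta> < 1" unfolding \<Theta> using D cl by simp_all
  have carrier: "A \<in> carrier_mat ?N ?N" "B \<in> carrier_mat ?N ?N" "I - ?c \<cdot>\<^sub>m A \<in> carrier_mat ?N ?N"
    "I + ?c \<cdot>\<^sub>m A \<in> carrier_mat ?N ?N"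
    using A B I by (auto intro!: minus_carrier_mat add_carrier_mat smult_carrier_mat)
  have \<epsilon>: "\<epsilon> l \<in> carrier_vec ?N" for l unfolding error using V_carrier Y_carrier by simp
  have N: "0 < dim_vec (\<epsilon> l)" for l using \<epsilon>[of l] by (simp add: grid_dim_def)
  have contraction: "max_norm (\<epsilon> l) \<le> \<Theta> * max_norm (\<epsilon> (l - 1))" if l: "l \<ge> 1" for l
  proof -
    have Bc: "B *\<^sub>v u \<in> carrier_vec ?N" if "u \<in> carrier_vec ?N" for u
      using carrier(2) that by (rule mult_mat_vec_carrier)
    have Cc: "(I + ?c \<cdot>\<^sub>m A) *\<^sub>v V n \<in> carrier_vec ?N"
      using carrier(4) V_carrier(1) by (rule mult_mat_vec_carrier)
    have "(I - ?c \<cdot>\<^sub>m A) *\<^sub>v \<epsilon> l = (I - ?c \<cdot>\<^sub>m A) *\<^sub>v V (n + 1) - (I - ?c \<cdot>\<^sub>m A) *\<^sub>v Y l"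
      unfolding error using carrier(3) V_carrier(2) Y_carrier by (rule mult_minus_distrib_mat_vec)
    \<comment> \<open>The two schemes share all terms in \<open>V n\<close>, which cancel in the
      difference.\<close>
    also have "\<dots> = ?c \<cdot>\<^sub>v (B *\<^sub>v V (n + 1) - B *\<^sub>v Y (l - 1))"
      unfolding crank_nicolson CNFI[OF l]
      using Cc Bc[OF V_carrier(1)] Bc[OF V_carrier(2)] Bc[OF Y_carrier[of "l - 1"]]
      by (intro eq_vecI) (auto simp: algebra_simps simp del: index_mult_mat_vec)
    also have "B *\<^sub>v V (n + 1) - B *\<^sub>v Y (l - 1) = B *\<^sub>v \<epsilon> (l - 1)"
      unfolding error
      using mult_minus_distrib_mat_vec[OF carrier(2) V_carrier(2) Y_carrier] by simp
    finally have eq: "(I - ?c \<cdot>\<^sub>m A) *\<^sub>v \<epsilon> l = ?c \<cdot>\<^sub>v (B *\<^sub>v \<epsilon> (l - 1))" .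
    \<comment> \<open>Brings the step-size term into the shape of the lower bound with
      \<open>c = \<Delta>t / 2\<close>.\<close>
    have q: "?q = ?c * (\<kappa>x / \<Delta>x + \<kappa>y / \<Delta>y)" by (simp add: field_simps)
    have "?D * max_norm (\<epsilon> l) \<le> max_norm ((I - ?c \<cdot>\<^sub>m A) *\<^sub>v \<epsilon> l)"
      unfolding q unfolding \<kappa>x \<kappa>y I A using c
      by (intro max_norm_implicit_step_ge upwind_weights_solve weights grid d sign_change \<epsilon>) simp
    also have "\<dots> = ?c * max_norm (B *\<^sub>v \<epsilon> (l - 1))"
      unfolding eq using c carrier_matD(1)[OF carrier(2)]
      by (subst max_norm_smult) (auto simp: grid_dim_def)
    also have "\<dots> \<le> ?c * (lam * max_norm (\<epsilon> (l - 1)))"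
      unfolding B using c params
      by (intro mult_left_mono max_norm_B_mat_le density d \<epsilon>) (auto simp: mesh algebra_simps)
    finally have "?D * max_norm (\<epsilon> l) \<le> ?c * lam * max_norm (\<epsilon> (l - 1))"
      by (simp only: mult.assoc)
    moreover have "0 < ?D" using D cl by linarith
    ultimately show ?thesis
      unfolding \<Theta> times_divide_eq_left by (simp only: pos_le_divide_eq mult.commute)
  qed
  \<comment> \<open>Iterating the contraction gives geometric decay; convergence follows by
    squeezing the norms between 0 and this bound.\<close>
  have "max_norm (\<epsilon> l) \<le> \<Theta> ^ l * max_norm (\<epsilon> 0)" for l
  proof (induction l)
    case (Suc l)
    have "max_norm (\<epsilon> (Suc l)) \<le> \<Theta> * max_norm (\<epsilon> l)"
      using contraction[of "Suc l"] by simp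
    also have "\<dots> \<le> \<Theta> * (\<Theta> ^ l * max_norm (\<epsilon> 0))"
      using Suc less_imp_le[OF \<Theta>_range(1)] by (rule mult_left_mono)
    finally show ?case by (simp only: power_Suc mult.assoc)
  qed simp
  then have upper: "\<forall>l. max_norm (\<epsilon> l) \<le> \<Theta> ^ l * max_norm (\<epsilon> 0)" ..
  have lower: "\<forall>l. 0 \<le> max_norm (\<epsilon> l)"
    using max_norm_nonneg[OF N] ..
  have "(\<lambda>l. \<Theta> ^ l * max_norm (\<epsilon> 0)) \<longlonglongrightarrow> 0"
    using \<Theta>_range by (intro tendsto_mult_left_zero LIMSEQ_power_zero) simp
  then have "(\<lambda>l. max_norm (\<epsilon> l)) \<longlonglongrightarrow> 0"
    by (rule tendsto_sandwich[OF always_eventually[OF lower] always_eventually[OF upper] tendsto_const])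
  then show ?thesis using \<Theta>_range(2) by (intro conjI allI impI contraction)
qed

end
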